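(* Let $\Omega\subseteq\mathbb R^2$ be open and simply connected, $\kappa_1>1$, $x_0\in\Omega$, $T$ a $C^1$ bijective map from $\Omega$ onto an open simply connected $\Omega^*\subseteq\mathbb R^2$, with $Sx=Tx-x$ satisfying $\nabla\times S=0$ and $S\times D|S|^2=0$ in a neighborhood of $x_0$, and $a>0$ with $a>\dfrac{|Sx_0|}{\sqrt{\kappa_1^2-1}}$. Let $\rho$ be a positive $C^2$ solution, in a neighborhood of $x_0$, of $$D(a-\rho(x))=\frac{\kappa_1\dfrac{Sx}{a-\rho(x)}}{\kappa_1-\sqrt{\left|\dfrac{Sx}{a-\rho(x)}\right|^2+1}}$$ with $a-\rho(x_0)=z_0$, where $a>z_0>\dfrac{|Sx_0|}{\sqrt{\kappa_1^2-1}}$. Let $$\mathcal A=I+\frac{\kappa_1^2-1}{\kappa_1^2}D\rho\otimes D\rho+\frac{(1-\kappa_1^2)(a-\rho)}{\kappa_1^2+\Delta}D^2\rho,\qquad \Delta=\sqrt{\kappa_1^2+(\kappa_1^2-1)|D\rho|^2}.$$ Then at $x=x_0$ $$D^2\rho=\frac{\varphi}{z_0}\left(I+\frac{2}{z_0^2}\frac{\varphi'}{\varphi}(S\otimes S)\right)\left(\frac{\varphi}{z_0^2}(S\otimes S)-DS\right),$$ $$\mathcal A=\left(I+\frac{2}{z_0^2}\frac{\varphi'}{\varphi}(S\otimes S)\right)(I+DS),$$ where $\varphi$ and $\varphi'$ are evaluated at $\left|\dfrac{Sx_0}{z_0}\right|^2$, and $S$, $DS$ are evaluated at $x_0$. Therefore,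 $\mathcal A$ is invertible at $x_0$ if and only if $DT=I+DS$ is invertible at $x_0$, i.e. $T$ is a diffeomorphism in a neighborhood of $x_0$. Moreover: (1) If $Sx_0=(0,0)$, i.e. $x_0$ is a fixed point of $T$, then $D^2\rho(x_0)$ is invertible if and only if $DS(x_0)$ is invertible. (2) If $Sx_0\neq(0,0)$, then, denoting by $\zeta$ and $\zeta_\perp$ the eigenvalues of $DS(x_0)$ corresponding to the eigenvectors $S^t$ and $S^t_\perp$ (at $x_0$), $D^2\rho(x_0)$ is invertible if and only if $\zeta\neq\dfrac{|Sx_0|^2}{z_0^2}\,\varphi\!\left(\left|\dfrac{Sx_0}{z_0}\right|^2\right)$ and $\zeta_\perp\neq0$.
   Context: Vectors are row vectors; $A\otimes B=A^tB$; $D$ of a scalar is its row gradient, $D^2$ the Hessian, $DS=(\partial S_i/\partial x_j)_{i,j}$; $I$ is the $2\times2$ identity. For a planar $C^1$ field $S=(S_1,S_2)$, $\nabla\times S=(S_2)_{x_1}-(S_1)_{x_2}$; for planar vectors ${\bf a}\times{\bf b}=a_1b_2-a_2b_1$; $S_\perp=(-S_2,S_1)$. The function $\varphi$ is $$\varphi(y)=\frac{\kappa_1}{\kappa_1-\sqrt{y+1}},\qquad y\in[0,\kappa_1^2-1),\qquad \varphi'(y)=\frac{\kappa_1}{2\sqrt{y+1}\,(\kappa_1-\sqrt{y+1})^2}.$$ The conditions $\nabla\times S=0$ and $S\times D|S|^2=0$ mean that $DS$ is symmetric and that $(DS)S^t$ is parallel to $S^t$; hence, where $S\neq(0,0)$,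 $S^t$ and $S_\perp^t$ are eigenvectors of $DS$. *)

theory Defs
  imports "HOL-Analysis.Analysis"
begin

definition grad :: "(real^2 \<Rightarrow> real) \<Rightarrow> real^2 \<Rightarrow> real^2" where
  "grad f x = (\<chi> j. frechet_derivative f (at x) (axis j 1))"

text \<open>Library convention: \<open>jacobian F (at x) $ i $ j\<close> is the derivative of the
  \<open>i\<close>-th component of \<open>F\<close> in direction \<open>j\<close>.\<close>

abbreviation D :: "(real^2 \<Rightarrow> real^2) \<Rightarrow> real^2 \<Rightarrow> real^2^2" where
  "D F x \<equiv> jacobian F (at x)"

definition hess :: "(real^2 \<Rightarrow> real) \<Rightarrow> real^2 \<Rightarrow> real^2^2" where
  "hess f x = D (grad f) x"

text \<open>The notions below are only meant for open \<open>U\<close>: derivatives are two-sided.\<close>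

definition C1_on :: "(real^2 \<Rightarrow> real^2) \<Rightarrow> (real^2) set \<Rightarrow> bool" where
  "C1_on F U \<longleftrightarrow> (\<forall>x\<in>U. F differentiable (at x)) \<and> continuous_on U (D F)"

definition C2_on :: "(real^2 \<Rightarrow> real) \<Rightarrow> (real^2) set \<Rightarrow> bool" where
  "C2_on f U \<longleftrightarrow> (\<forall>x\<in>U. f differentiable (at x)) \<and> C1_on (grad f) U"

definition local_diffeomorphism_at ::
    "(real^2 \<Rightarrow> real^2) \<Rightarrow> (real^2) set \<Rightarrow> real^2 \<Rightarrow> bool" where
  "local_diffeomorphism_at F \<Omega> x \<longleftrightarrow>
     (\<exists>U V G. open U \<and> x \<in> U \<and> U \<subseteq> \<Omega> \<and> open V \<and>
        homeomorphism U V F G \<and> C1_on F U \<and> C1_on G V)"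

definition outer :: "real^2 \<Rightarrow> real^2 \<Rightarrow> real^2^2" where
  "outer A B = (\<chi> i j. A $ i * B $ j)"

definition cross2 :: "real^2 \<Rightarrow> real^2 \<Rightarrow> real" where
  "cross2 A B = A $ 1 * B $ 2 - A $ 2 * B $ 1"

definition perp :: "real^2 \<Rightarrow> real^2" where
  "perp A = vector [- (A $ 2), A $ 1]"

definition curl2 :: "(real^2 \<Rightarrow> real^2) \<Rightarrow> real^2 \<Rightarrow> real" where
  "curl2 F x = D F x $ 2 $ 1 - D F x $ 1 $ 2"

definition phi :: "real \<Rightarrow> real \<Rightarrow> real" where
  "phi \<kappa> y = \<kappa> / (\<kappa> - sqrt (y + 1))"

text \<open>The domain of interest is \<open>0 \<le> y < \<kappa>\<^sup>2 - 1\<close>. The total function \<open>phi \<kappa>\<close> is differentiable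
  on the larger interval \<open>-1 < y < \<kappa>\<^sup>2 - 1\<close>, so the two-sided \<open>deriv (phi \<kappa>) 0\<close> is the
  intended one-sided derivative.\<close>

lemma deriv_phi:
  assumes "\<kappa> > 1" "- 1 < y" "y < \<kappa>\<^sup>2 - 1"
  shows "deriv (phi \<kappa>) y = \<kappa> / (2 * sqrt (y + 1) * (\<kappa> - sqrt (y + 1))\<^sup>2)"
proof (rule DERIV_imp_deriv)
  have "sqrt (y + 1) < sqrt (\<kappa>\<^sup>2)"
    using assms by (intro real_sqrt_less_mono) simp
  then have *: "\<kappa> - sqrt (y + 1) \<noteq> 0"
    using assms by simp
  have "sqrt (y + 1) > 0"
    using assms by simp
  with * show "(phi \<kappa> has_real_derivative \<kappa> / (2 * sqrt (y + 1) * (\<kappa> - sqrt (y + 1))\<^sup>2)) (at y)"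
    unfolding phi_def[abs_def] using assms
    by (auto intro!: derivative_eq_intros simp: power2_eq_square divide_simps)
qed

definition Delta :: "real \<Rightarrow> (real^2 \<Rightarrow> real) \<Rightarrow> real^2 \<Rightarrow> real" where
  "Delta \<kappa> \<rho> x = sqrt (\<kappa>\<^sup>2 + (\<kappa>\<^sup>2 - 1) * (norm (grad \<rho> x))\<^sup>2)"

definition matA :: "real \<Rightarrow> real \<Rightarrow> (real^2 \<Rightarrow> real) \<Rightarrow> real^2 \<Rightarrow> real^2^2" where
  "matA \<kappa> a \<rho> x =
     mat 1 + ((\<kappa>\<^sup>2 - 1) / \<kappa>\<^sup>2) *\<^sub>R outer (grad \<rho> x) (grad \<rho> x)
       + ((1 - \<kappa>\<^sup>2) * (a - \<rho> x) / (\<kappa>\<^sup>2 + Delta \<kappa> \<rho> x)) *\<^sub>R hess \<rho> x"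

end

theory Submission
  imports Defs
begin

text \<open>
  Near \<open>x0\<close> the equation reads \<open>D\<rho> = - (\<phi>(|S|\<^sup>2/w\<^sup>2) / w) S\<close> with \<open>w = a - \<rho>\<close>. Differentiating it,
  with \<open>Dw = (\<phi>/z0) S\<close> at \<open>x0\<close>, gives the Hessian. Writing \<open>q = sqrt (y + 1)\<close>, the radicand of \<open>\<Delta>\<close>
  is the square of \<open>\<kappa> (\<kappa> q - 1) / (\<kappa> - q)\<close>, so \<open>\<kappa>\<^sup>2 + \<Delta> = (\<kappa>\<^sup>2 - 1) \<phi>\<close>; thus \<open>D\<^sup>2\<rho>\<close> enters \<open>\<A>\<close> with
  factor \<open>- z0/\<phi>\<close>, and the factorization of \<open>\<A>\<close> comes down to a scalar identity between \<open>\<phi>\<close> and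
  \<open>\<phi>'\<close>. The common left factor \<open>I + (2\<phi>'/(z0\<^sup>2 \<phi>)) S \<otimes> S\<close> has positive determinant, so invertibility
  is decided by the right factors; that of \<open>D\<^sup>2\<rho>\<close> is diagonal in the basis \<open>S, S\<^sub>\<perp>\<close>.
\<close>

section \<open>Calculus and linear algebra in the plane\<close>

lemma matrix_eqI2:
  fixes A B :: "real^2^2"
  assumes "A$1$1 = B$1$1" "A$1$2 = B$1$2" "A$2$1 = B$2$1" "A$2$2 = B$2$2"
  shows "A = B"
  using assms by (simp add: vec_eq_iff forall_2)

lemma D_eqI: "(F has_derivative (*v) A) (at x) \<Longrightarrow> D F x = A"
  by (metis frechet_derivative_at jacobian_def matrix_of_matrix_vector_mul)

lemma grad_eqI:
  assumes "(f has_derivative (\<lambda>h. v \<bullet> h)) (at x)"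
  shows "grad f x = v"
proof -
  have "frechet_derivative f (at x) = (\<lambda>h. v \<bullet> h)"
    using frechet_derivative_at[OF assms] by simp
  then show ?thesis
    by (simp add: grad_def vec_eq_iff inner_axis)
qed

text \<open>The vector \<open>grad f x\<close> only records the derivative on the two basis vectors;
  linearity recovers it in every direction.\<close>

lemma has_derivative_grad:
  assumes "f differentiable (at x)"
  shows "(f has_derivative (\<lambda>h. grad f x \<bullet> h)) (at x)"
proof -
  let ?f' = "frechet_derivative f (at x)"
  have d: "(f has_derivative ?f') (at x)"
    using assms by (simp add: frechet_derivative_works)
  then have lin: "linear ?f'"
    by (rule has_derivative_linear)
  have "?f' h = grad f x \<bullet> h" for h
  proof -
    have "h = (h$1) *\<^sub>R axis 1 1 + (h$2) *\<^sub>R axis 2 1"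
      by (simp add: vec_eq_iff forall_2 axis_def)
    then have "?f' h = ?f' ((h$1) *\<^sub>R axis 1 1 + (h$2) *\<^sub>R axis 2 1)"
      by simp
    also have "\<dots> = grad f x \<bullet> h"
      using lin by (simp add: grad_def inner_vec_def sum_2 linear_add linear_cmul mult.commute)
    finally show ?thesis .
  qed
  then have "?f' = (\<lambda>h. grad f x \<bullet> h)"
    by blast
  then show ?thesis
    using d by simp
qed

lemma has_derivative_norm_square:
  fixes S :: "real^2 \<Rightarrow> real^2"
  assumes "(S has_derivative (*v) A) (at x)"
  shows "((\<lambda>y. (norm (S y))\<^sup>2) has_derivative (\<lambda>h. 2 * (S x \<bullet> (A *v h)))) (at x)"
  unfolding power2_norm_eq_inner
  by (rule derivative_eq_intros assms refl ext | simp add: inner_commute)+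

lemma matrix_mult_diff_distrib:
  fixes A B C :: "real^'n^'n"
  shows "A ** (B - C) = A ** B - A ** C"
  by (simp add: matrix_eq matrix_vector_mult_diff_rdistrib matrix_vector_mult_diff_distrib
      flip: matrix_vector_mul_assoc)

lemma outer_mult_vector: "outer v w *v h = (w \<bullet> h) *\<^sub>R v"
  by (simp add: outer_def matrix_vector_mult_def vec_eq_iff sum_2 forall_2 inner_vec_def algebra_simps)

lemma det_mat_plus_outer: "det (mat 1 + c *\<^sub>R outer s s) = 1 + c * (norm s)\<^sup>2"
  by (simp add: det_2 outer_def mat_def power2_norm_eq_inner inner_vec_def sum_2 algebra_simps)

text \<open>The matrix \<open>?P\<close> with columns \<open>s\<close> and \<open>perp s\<close> has
  determinant |s|^2, which is nonzero, and multiplying it by \<open>B\<close> from the left scales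
  its columns by \<alpha> and \<beta>. Comparing determinants gives the claim.\<close>

lemma det_eq_prod_of_orthogonal_eigenvalues:
  fixes B :: "real^2^2"
  assumes "B *v s = \<alpha> *\<^sub>R s" "B *v perp s = \<beta> *\<^sub>R perp s" "s \<noteq> 0"
  shows "det B = \<alpha> * \<beta>"
proof -
  let ?P = "(\<chi> i j. if j = 1 then s$i else perp s$i) :: real^2^2"
  have dP: "det ?P = (norm s)\<^sup>2"
    by (simp add: det_2 perp_def power2_norm_eq_inner inner_vec_def sum_2)
  have "det B * det ?P = det (B ** ?P)"
    by (simp add: det_mul)
  also have "B ** ?P = (\<chi> i j. if j = 1 then (\<alpha> *\<^sub>R s)$i else (\<beta> *\<^sub>R perp s)$i)"
    by (simp add: vec_eq_iff matrix_matrix_mult_def matrix_vector_mult_def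
        flip: assms(1,2))
  also have "det \<dots> = \<alpha> * \<beta> * (norm s)\<^sup>2"
    by (simp add: det_2 perp_def power2_norm_eq_inner inner_vec_def sum_2 algebra_simps)
  finally show ?thesis
    using dP assms(3) by simp
qed

section \<open>Invertible Jacobians and local diffeomorphisms\<close>

lemma continuous_on_matrix_left_inverse:
  fixes A B :: "real^2 \<Rightarrow> real^2^2"
  assumes "continuous_on V A" "\<And>y. y \<in> V \<Longrightarrow> B y ** A y = mat 1"
  shows "continuous_on V B"
proof -
  \<comment> \<open>The adjugate of \<open>A y\<close> divided by its determinant: diagonal entries
    swapped, the others negated. It depends continuously on the entries of \<open>A y\<close>, and
    it must equal \<open>B y\<close>, since a left and a right inverse of \<open>A y\<close>
    coincide.\<close>
  let ?C = "\<lambda>y. (1 / det (A y)) *\<^sub>R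
    (\<chi> i j. if i = j then (if i = 1 then A y $ 2 $ 2 else A y $ 1 $ 1) else - A y $ i $ j) :: real^2^2"
  have nz: "det (A y) \<noteq> 0" if "y \<in> V" for y
    using assms(2)[OF that] by (metis det_I det_mul mult_zero_right zero_neq_one)
  have C: "A y ** ?C y = mat 1" if "y \<in> V" for y
  proof -
    have "det (A y) *\<^sub>R (A y ** ?C y) = det (A y) *\<^sub>R mat 1"
      using nz[OF that]
      by (intro matrix_eqI2)
        (simp_all add: matrix_matrix_mult_def sum_2 mat_def divide_simps, simp_all add: det_2 algebra_simps)
    then show ?thesis
      using nz[OF that] by simp
  qed
  have BC: "B y = ?C y" if "y \<in> V" for y
  proof -
    have "B y = B y ** (A y ** ?C y)"
      by (simp only: C[OF that] matrix_mul_rid)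
    also have "\<dots> = ?C y"
      by (simp only: matrix_mul_assoc assms(2)[OF that] matrix_mul_lid)
    finally show ?thesis .
  qed
  have ent: "continuous_on V (\<lambda>y. A y $ i $ j)" for i j
    by (intro continuous_intros assms)
  have "continuous_on V (\<lambda>y. det (A y))"
    unfolding det_2 by (intro continuous_intros assms)
  moreover have "continuous_on V (\<lambda>y. if i = j then (if i = 1 then A y $ 2 $ 2 else A y $ 1 $ 1)
      else - A y $ i $ j)" for i j
    by (cases "i = j"; cases "i = 1") (simp_all add: ent continuous_on_minus[OF ent])
  ultimately have "continuous_on V ?C"
    using nz by (intro continuous_intros) auto
  then show ?thesis
    by (subst continuous_on_cong[OF refl BC])
qed

text \<open>The chain rule applied to \<open>G (F y) = y\<close>, valid on an open set around
  \<open>x\<close>, makes \<open>D G (F x)\<close> a left inverse of \<open>D F x\<close>; for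
  square matrices this is enough.\<close>

lemma invertible_D_if_local_diffeomorphism:
  assumes "local_diffeomorphism_at F \<Omega> x"
  shows "invertible (D F x)"
proof -
  obtain U V G where U: "open U" "x \<in> U" and hom: "homeomorphism U V F G"
    and F: "C1_on F U" and G: "C1_on G V"
    using assms unfolding local_diffeomorphism_at_def by blast
  have "(F has_derivative (*v) (D F x)) (at x)"
    using F U by (simp add: C1_on_def jacobian_works)
  moreover have "F x \<in> V"
    using hom U by (auto simp: homeomorphism_def)
  then have "(G has_derivative (*v) (D G (F x))) (at (F x))"
    using G by (simp add: C1_on_def jacobian_works)
  ultimately have "((\<lambda>y. G (F y)) has_derivative (\<lambda>h. D G (F x) *v (D F x *v h))) (at x)"
    by (rule has_derivative_compose)
  moreover have "((\<lambda>y. G (F y)) has_derivative (\<lambda>h. h)) (at x)"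
    using has_derivative_ident U
    by (rule has_derivative_transform_within_open) (use hom in \<open>auto simp: homeomorphism_def\<close>)
  ultimately have "(\<lambda>h. D G (F x) *v (D F x *v h)) = (\<lambda>h. h)"
    by (rule has_derivative_unique)
  then have "D G (F x) ** D F x = mat 1"
    by (simp add: fun_eq_iff matrix_eq matrix_vector_mul_assoc)
  then show ?thesis
    using invertible_left_inverse by blast
qed

text \<open>The inverse function theorem supplies the homeomorphism and the derivative of the local
  inverse \<open>G\<close>. What remains is that this derivative is continuous: it is the inverse of
  \<open>D F\<close> at \<open>G y\<close>, hence continuous in \<open>y\<close>.\<close>

lemma local_diffeomorphism_if_invertible_D:
  assumes "open \<Omega>" "x \<in> \<Omega>" and F: "C1_on F \<Omega>" and inv: "invertible (D F x)"
  shows "local_diffeomorphism_at F \<Omega> x"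
proof -
  \<comment> \<open>The inverse function theorem takes the derivative as a map into bounded linear
    operators; in finite dimension its continuity can be checked on each fixed vector.\<close>
  define F' where "F' y = Blinfun ((*v) (D F y))" for y
  have F'_app [simp]: "blinfun_apply (F' y) = (*v) (D F y)" for y
    by (simp add: F'_def bounded_linear_Blinfun_apply)
  obtain B where B: "B ** D F x = mat 1"
    using inv invertible_left_inverse by blast
  have der: "(F has_derivative blinfun_apply (F' y)) (at y)" if "y \<in> \<Omega>" for y
    using F that by (simp add: C1_on_def jacobian_works)
  have cont: "continuous_on \<Omega> F'"
  proof (rule continuous_on_blinfun_componentwise)
    fix i :: "real^2"
    have "continuous_on \<Omega> (D F)"
      using F by (simp add: C1_on_def)
    then have "continuous_on \<Omega> (\<lambda>y. \<chi> k. D F y $ k \<bullet> i)"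
      by (intro continuous_intros)
    moreover have "D F y *v i = (\<chi> k. D F y $ k \<bullet> i)" for y
      by (simp add: vec_eq_iff matrix_vector_mul_component)
    ultimately show "continuous_on \<Omega> (\<lambda>y. blinfun_apply (F' y) i)"
      by simp
  qed
  have "Blinfun ((*v) B) o\<^sub>L F' x = id_blinfun"
    by (rule blinfun_eqI) (simp add: bounded_linear_Blinfun_apply matrix_vector_mul_assoc B)
  from inverse_function_theorem[OF assms(1) der cont assms(2) this]
  obtain U V G G' where U: "open U" "U \<subseteq> \<Omega>" "x \<in> U" "open V" "F x \<in> V" "homeomorphism U V F G"
    and G: "\<And>y. y \<in> V \<Longrightarrow> (G has_derivative G' y) (at y)"
    and G': "\<And>y. y \<in> V \<Longrightarrow> G' y = inv (blinfun_apply (F' (G y)))"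
    and bij: "\<And>y. y \<in> V \<Longrightarrow> bij (blinfun_apply (F' (G y)))"
    by this (assumption, rule that, assumption+)
  have FU: "C1_on F U"
    using F U(2) continuous_on_subset unfolding C1_on_def by blast
  have left_inv: "D G y ** D F (G y) = mat 1" if y: "y \<in> V" for y
  proof -
    have "(G has_derivative (*v) (D G y)) (at y)"
      using differentiableI[OF G[OF y]] by (simp only: jacobian_works)
    then have "G' y = (*v) (D G y)"
      by (rule has_derivative_unique[OF G[OF y]])
    then have "D G y *v (D F (G y) *v h) = h" for h
      using inv_f_f[OF bij_is_inj[OF bij[OF y]], of h] unfolding G'[OF y, symmetric] by simp
    then show ?thesis
      by (simp add: matrix_eq flip: matrix_vector_mul_assoc)
  qed
  have "continuous_on V (\<lambda>y. D F (G y))"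
  proof -
    have "continuous_on U (D F)"
      using FU by (simp add: C1_on_def)
    moreover have "continuous_on V G" "G ` V \<subseteq> U"
      using U(6) by (simp_all add: homeomorphism_def)
    ultimately show ?thesis
      by (rule continuous_on_compose2)
  qed
  then have "continuous_on V (D G)"
    using left_inv by (rule continuous_on_matrix_left_inverse)
  then have "C1_on G V"
    using differentiableI[OF G] by (simp add: C1_on_def)
  then show ?thesis
    unfolding local_diffeomorphism_at_def using U FU by (intro exI[of _ U] exI[of _ V] exI[of _ G] conjI)
qed


section \<open>Scalar identities for \<phi> and its derivative\<close>

context
  fixes \<kappa> y :: real
  assumes \<kappa>: "\<kappa> > 1" and y: "0 \<le> y" "y < \<kappa>\<^sup>2 - 1"
begin

lemma sqrt_less_kappa: "sqrt (y + 1) < \<kappa>"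
proof -
  have "sqrt (y + 1) < sqrt (\<kappa>\<^sup>2)"
    using y by (intro real_sqrt_less_mono) simp
  then show ?thesis
    using \<kappa> by simp
qed

lemma phi_pos: "phi \<kappa> y > 0"
  using sqrt_less_kappa \<kappa> by (simp add: phi_def)

text \<open>Absorbing the squared denominator into \<phi>^2 makes the sign of \<phi>'
  visible.\<close>

lemma deriv_phi_eq: "deriv (phi \<kappa>) y = (phi \<kappa> y)\<^sup>2 / (2 * \<kappa> * sqrt (y + 1))"
proof -
  have "deriv (phi \<kappa>) y = \<kappa> / (2 * sqrt (y + 1) * (\<kappa> - sqrt (y + 1))\<^sup>2)"
    using y by (intro deriv_phi \<kappa>) auto
  then show ?thesis
    using \<kappa> by (simp add: phi_def power2_eq_square mult.commute)
qed

text \<open>Differentiability holds because y + 1 > 0 and the denominator does not vanish. The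
  derivative is two-sided even at y = 0, the value attained at a fixed point of
  \<open>T\<close>.\<close>

lemma phi_has_real_derivative: "(phi \<kappa> has_real_derivative deriv (phi \<kappa>) y) (at y)"
proof -
  have "\<exists>d. (phi \<kappa> has_real_derivative d) (at y)"
    unfolding phi_def[abs_def] using y \<kappa> sqrt_less_kappa
    by (intro exI) (auto intro!: derivative_eq_intros)
  then show ?thesis
    using DERIV_deriv_iff_has_field_derivative by blast
qed

text \<open>This is the condition, multiplied by \<open>z0\<^sup>2\<close>, under which the
  coefficients of \<open>outer s s\<close> match in the factorization of \<open>matA\<close>. With q
  = sqrt (y + 1) and r = \<kappa> - q, the left side over the common denominator q r^2 has a
  numerator that collapses to r, so both sides equal 1 / (q r).\<close>

lemma phi_identity:
  "(\<kappa>\<^sup>2 - 1) / \<kappa>\<^sup>2 * (phi \<kappa> y)\<^sup>2 - phi \<kappa> y - 2 * deriv (phi \<kappa>) y * y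
     = 2 * (deriv (phi \<kappa>) y / phi \<kappa> y)"
proof -
  define q where "q = sqrt (y + 1)"
  define r where "r = \<kappa> - q"
  have q: "q > 0" and yq: "y = q\<^sup>2 - 1"
    using y by (auto simp: q_def)
  have r: "r > 0" and \<kappa>q: "\<kappa> = r + q"
    using sqrt_less_kappa by (auto simp: q_def r_def)
  have p: "phi \<kappa> y = \<kappa> / r"
    by (simp add: phi_def q_def r_def)
  have d: "deriv (phi \<kappa>) y = \<kappa> / (2 * q * r\<^sup>2)"
    using \<kappa> q r unfolding deriv_phi_eq p by (simp add: power2_eq_square flip: q_def)
  have "\<kappa> \<noteq> 0"
    using \<kappa> by simp
  then have "(\<kappa>\<^sup>2 - 1) / \<kappa>\<^sup>2 * (\<kappa> / r)\<^sup>2 - \<kappa> / r - 2 * (\<kappa> / (2 * q * r\<^sup>2)) * (q\<^sup>2 - 1)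
      = (\<kappa>\<^sup>2 - 1) / r\<^sup>2 - \<kappa> / r - \<kappa> * (q\<^sup>2 - 1) / (q * r\<^sup>2)"
    by (simp add: power_divide)
  also have "\<dots> = ((\<kappa>\<^sup>2 - 1) * q - \<kappa> * r * q - \<kappa> * (q\<^sup>2 - 1)) / (q * r\<^sup>2)"
    using q r by (simp add: field_simps power2_eq_square)
  also have "(\<kappa>\<^sup>2 - 1) * q - \<kappa> * r * q - \<kappa> * (q\<^sup>2 - 1) = r"
    unfolding \<kappa>q by (simp add: algebra_simps power2_eq_square)
  also have "r / (q * r\<^sup>2) = 2 * (\<kappa> / (2 * q * r\<^sup>2) / (\<kappa> / r))"
    using q r \<open>\<kappa> \<noteq> 0\<close> by (simp add: field_simps power2_eq_square)
  finally show ?thesis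
    by (simp add: p d flip: yq)
qed

text \<open>Here \<phi>^2 y is the value of |D\<rho>|^2 at \<open>x0\<close>, so the square root is
  \<open>Delta\<close> there.\<close>

lemma Delta_identity:
  "\<kappa>\<^sup>2 + sqrt (\<kappa>\<^sup>2 + (\<kappa>\<^sup>2 - 1) * ((phi \<kappa> y)\<^sup>2 * y)) = (\<kappa>\<^sup>2 - 1) * phi \<kappa> y"
proof -
  define q where "q = sqrt (y + 1)"
  have q: "q \<ge> 1" and yq: "y = q\<^sup>2 - 1"
    using y by (auto simp: q_def)
  have r: "\<kappa> - q > 0"
    using sqrt_less_kappa by (simp add: q_def)
  have p: "phi \<kappa> y = \<kappa> / (\<kappa> - q)"
    by (simp add: phi_def q_def)
  have "\<kappa>\<^sup>2 + (\<kappa>\<^sup>2 - 1) * ((phi \<kappa> y)\<^sup>2 * y)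
      = \<kappa>\<^sup>2 * ((\<kappa> - q)\<^sup>2 + (\<kappa>\<^sup>2 - 1) * (q\<^sup>2 - 1)) / (\<kappa> - q)\<^sup>2"
    unfolding p unfolding yq using r
    by (simp add: power_divide add_divide_distrib distrib_left mult.assoc mult.left_commute)
  also have "(\<kappa> - q)\<^sup>2 + (\<kappa>\<^sup>2 - 1) * (q\<^sup>2 - 1) = (\<kappa> * q - 1)\<^sup>2"
    by (simp add: power2_eq_square algebra_simps)
  finally have "\<kappa>\<^sup>2 + (\<kappa>\<^sup>2 - 1) * ((phi \<kappa> y)\<^sup>2 * y) = (\<kappa> * (\<kappa> * q - 1) / (\<kappa> - q))\<^sup>2"
    by (simp add: power_divide power_mult_distrib)
  \<comment> \<open>This sign selects the right root of the perfect square.\<close>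
  moreover have "\<kappa> * q \<ge> 1"
    using \<kappa> q mult_mono[of 1 \<kappa> 1 q] by simp
  ultimately have "sqrt (\<kappa>\<^sup>2 + (\<kappa>\<^sup>2 - 1) * ((phi \<kappa> y)\<^sup>2 * y)) = \<kappa> * (\<kappa> * q - 1) / (\<kappa> - q)"
    using \<kappa> r by simp
  then show ?thesis
    unfolding p using r by (simp add: field_simps power2_eq_square)
qed

end

section \<open>Jacobian of the right-hand side of the equation, and the factorization of the
  matrices\<close>

lemma has_derivative_scaled_field:
  fixes S :: "real^2 \<Rightarrow> real^2" and w :: "real^2 \<Rightarrow> real"
  assumes S: "(S has_derivative (*v) A) (at x)"
    and w: "(w has_derivative (\<lambda>h. (p / z) * (s \<bullet> h))) (at x)"
    and f: "(f has_real_derivative f') (at ((norm (s /\<^sub>R z))\<^sup>2))"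
    and "S x = s" "w x = z" "z \<noteq> 0" "f ((norm (s /\<^sub>R z))\<^sup>2) = p" "p \<noteq> 0"
  shows "((\<lambda>x. - (f ((norm (S x /\<^sub>R w x))\<^sup>2) / w x) *\<^sub>R S x) has_derivative
    (*v) ((p / z) *\<^sub>R ((mat 1 + (2 / z\<^sup>2 * (f' / p)) *\<^sub>R outer s s)
       ** ((p / z\<^sup>2) *\<^sub>R outer s s - A)))) (at x)"
proof -
  have N: "((\<lambda>x. (norm (S x))\<^sup>2) has_derivative (\<lambda>h. 2 * (s \<bullet> (A *v h)))) (at x)"
    using has_derivative_norm_square[OF S] assms by simp
  \<comment> \<open>The power z^4 arises from inserting the derivative (p / z) (s \<bullet> h) of
    \<open>w\<close> into the quotient-rule term -2 |s|^2 w' / z^3. As \<open>w\<close> also has its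
    gradient along \<open>s\<close>, every term of the final derivative except the one with
    \<open>A *v h\<close> is a multiple of \<open>s\<close>.\<close>
  have Y: "((\<lambda>x. (norm (S x))\<^sup>2 / (w x)\<^sup>2) has_derivative
      (\<lambda>h. 2 * (s \<bullet> (A *v h)) / z\<^sup>2 - 2 * (norm s)\<^sup>2 * p / z^4 * (s \<bullet> h))) (at x)"
    by (rule derivative_eq_intros N w refl | simp add: assms(4-6))+
      (use assms(6) in \<open>auto simp: fun_eq_iff field_simps power2_eq_square power4_eq_xxxx assms(4,5)\<close>)
  have n: "(norm (u /\<^sub>R c))\<^sup>2 = (norm u)\<^sup>2 / c\<^sup>2" for u :: "real^2" and c :: real
    by (simp add: power_mult_distrib divide_simps)
  have F: "((\<lambda>x. f ((norm (S x))\<^sup>2 / (w x)\<^sup>2)) has_derivative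
      (\<lambda>h. f' * (2 * (s \<bullet> (A *v h)) / z\<^sup>2 - 2 * (norm s)\<^sup>2 * p / z^4 * (s \<bullet> h)))) (at x)"
    using has_derivative_compose[OF Y, of f "(*) f'"] f[unfolded n]
    by (simp add: has_field_derivative_def assms(4,5))
  have *: "f ((norm s)\<^sup>2 / z\<^sup>2) = p"
    using assms(7) unfolding n .
  have "((\<lambda>x. f ((norm (S x))\<^sup>2 / (w x)\<^sup>2) / w x) has_derivative
     (\<lambda>h. f' * (2 * (s \<bullet> (A *v h)) / z\<^sup>2 - 2 * (norm s)\<^sup>2 * p / z^4 * (s \<bullet> h)) / z
       - p * (p / z * (s \<bullet> h)) / z\<^sup>2)) (at x)"
    using has_derivative_divide'[OF F w, unfolded assms(4,5) *] assms(6)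
    by (simp add: diff_divide_distrib power2_eq_square)
  from has_derivative_minus[OF has_derivative_scaleR[OF this S]]
  have "((\<lambda>x. - (f ((norm (S x))\<^sup>2 / (w x)\<^sup>2) / w x) *\<^sub>R S x) has_derivative
     (\<lambda>h. - (p / z) *\<^sub>R (A *v h) - (f' * (2 * (s \<bullet> (A *v h)) / z\<^sup>2
         - 2 * (norm s)\<^sup>2 * p / z^4 * (s \<bullet> h)) / z - p * (p / z * (s \<bullet> h)) / z\<^sup>2) *\<^sub>R s)) (at x)"
    by (simp only: assms(4,5) * minus_add_distrib scaleR_minus_left add_uminus_conv_diff)
  also have "(\<lambda>h. - (p / z) *\<^sub>R (A *v h) - (f' * (2 * (s \<bullet> (A *v h)) / z\<^sup>2
         - 2 * (norm s)\<^sup>2 * p / z^4 * (s \<bullet> h)) / z - p * (p / z * (s \<bullet> h)) / z\<^sup>2) *\<^sub>R s)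
    = (*v) ((p / z) *\<^sub>R ((mat 1 + (2 / z\<^sup>2 * (f' / p)) *\<^sub>R outer s s)
       ** ((p / z\<^sup>2) *\<^sub>R outer s s - A)))"
  proof
    fix h
    have "((p / z) *\<^sub>R ((mat 1 + (2 / z\<^sup>2 * (f' / p)) *\<^sub>R outer s s)
       ** ((p / z\<^sup>2) *\<^sub>R outer s s - A))) *v h
      = (p / z) *\<^sub>R ((p / z\<^sup>2 * (s \<bullet> h)) *\<^sub>R s - A *v h
         + (2 / z\<^sup>2 * (f' / p) * (p / z\<^sup>2 * (s \<bullet> h) * (norm s)\<^sup>2 - s \<bullet> (A *v h))) *\<^sub>R s)"
      by (simp add: outer_mult_vector matrix_vector_mult_add_rdistrib matrix_vector_mult_diff_rdistrib
          inner_diff_right power2_norm_eq_inner flip: matrix_vector_mul_assoc scaleR_matrix_vector_assoc)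
    also have "\<dots> = - (p / z) *\<^sub>R (A *v h) + (p / z * (p / z\<^sup>2 * (s \<bullet> h)
         + 2 / z\<^sup>2 * (f' / p) * (p / z\<^sup>2 * (s \<bullet> h) * (norm s)\<^sup>2 - s \<bullet> (A *v h)))) *\<^sub>R s"
      by (simp add: algebra_simps)
    \<comment> \<open>Comparison of the coefficients of \<open>s\<close>: the outer factor p / z
      cancels the p in f' / p.\<close>
    also have "p / z * (p / z\<^sup>2 * (s \<bullet> h)
         + 2 / z\<^sup>2 * (f' / p) * (p / z\<^sup>2 * (s \<bullet> h) * (norm s)\<^sup>2 - s \<bullet> (A *v h)))
       = - (f' * (2 * (s \<bullet> (A *v h)) / z\<^sup>2
         - 2 * (norm s)\<^sup>2 * p / z^4 * (s \<bullet> h)) / z - p * (p / z * (s \<bullet> h)) / z\<^sup>2)"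
      using assms(6,8) by (simp add: field_simps power2_eq_square power4_eq_xxxx)
    finally show "- (p / z) *\<^sub>R (A *v h) - (f' * (2 * (s \<bullet> (A *v h)) / z\<^sup>2
         - 2 * (norm s)\<^sup>2 * p / z^4 * (s \<bullet> h)) / z - p * (p / z * (s \<bullet> h)) / z\<^sup>2) *\<^sub>R s
      = ((p / z) *\<^sub>R ((mat 1 + (2 / z\<^sup>2 * (f' / p)) *\<^sub>R outer s s)
       ** ((p / z\<^sup>2) *\<^sub>R outer s s - A))) *v h"
      by (simp only: scaleR_minus_left add_uminus_conv_diff)
  qed
  finally show ?thesis
    by (simp only: n)
qed

text \<open>The square of \<open>outer s s\<close> is |s|^2 times itself, so M = I + m
  \<open>outer s s\<close> times c \<open>outer s s\<close> is again a multiple of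
  \<open>outer s s\<close>. The hypothesis says that subtracting it from I + k
  \<open>outer s s\<close> leaves exactly M, and then M + M A = M (I + A).\<close>

lemma mat_plus_outer_mult:
  assumes "k - c * (1 + m * (norm s)\<^sup>2) = m"
  shows "mat 1 + k *\<^sub>R outer s s - (mat 1 + m *\<^sub>R outer s s) ** (c *\<^sub>R outer s s - A)
    = (mat 1 + m *\<^sub>R outer s s) ** (mat 1 + A)"
proof -
  have "(mat 1 + m *\<^sub>R outer s s) ** (c *\<^sub>R outer s s)
      = (c * (1 + m * (norm s)\<^sup>2)) *\<^sub>R outer s s"
    unfolding matrix_eq
    by (simp add: outer_mult_vector matrix_vector_mult_add_rdistrib power2_norm_eq_inner algebra_simps
        flip: matrix_vector_mul_assoc scaleR_matrix_vector_assoc)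
  moreover have "k = m + c * (1 + m * (norm s)\<^sup>2)"
    using assms by simp
  ultimately show ?thesis
    by (simp only: matrix_add_ldistrib matrix_mult_diff_distrib matrix_mul_rid scaleR_add_left) simp
qed

text \<open>A vanishing cross product means that \<open>A *v s\<close> is parallel to
  \<open>s\<close>. For symmetric \<open>A\<close> the cross product of \<open>perp s\<close> with
  its image is the same quantity up to sign, so \<open>perp s\<close> is an eigenvector as
  well.\<close>

lemma symmetric_eigenvectors:
  fixes A :: "real^2^2"
  assumes sym: "A $ 2 $ 1 = A $ 1 $ 2" and cross: "cross2 s (A *v s) = 0" and "s \<noteq> 0"
  shows "\<exists>\<zeta>. A *v s = \<zeta> *\<^sub>R s" "\<exists>\<zeta>. A *v perp s = \<zeta> *\<^sub>R perp s"
proof -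
  have parallel: "\<exists>c. v = c *\<^sub>R u" if "cross2 u v = 0" "u \<noteq> 0" for u v
  proof -
    \<comment> \<open>The difference of the two sides is \<open>cross2 u v\<close> times
      \<open>perp u\<close>.\<close>
    have "(u \<bullet> u) *\<^sub>R v = (u \<bullet> v) *\<^sub>R u"
      using that(1) by (simp add: vec_eq_iff forall_2 inner_vec_def sum_2 cross2_def algebra_simps)
    moreover have "u \<bullet> u \<noteq> 0"
      using that(2) by simp
    ultimately have "v = ((u \<bullet> v) / (u \<bullet> u)) *\<^sub>R u"
      by (metis (no_types) divide_inverse mult.commute scaleR_scaleR scaleR_one left_inverse)
    then show ?thesis ..
  qed
  show "\<exists>\<zeta>. A *v s = \<zeta> *\<^sub>R s"
    using parallel cross \<open>s \<noteq> 0\<close> by blast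
  have "cross2 (perp s) (A *v perp s) = 0"
    using cross by (simp add: cross2_def perp_def matrix_vector_mult_def sum_2 sym algebra_simps)
  moreover have "perp s \<noteq> 0"
    using \<open>s \<noteq> 0\<close> by (auto simp: perp_def vec_eq_iff forall_2)
  ultimately show "\<exists>\<zeta>. A *v perp s = \<zeta> *\<^sub>R perp s"
    using parallel by blast
qed



section \<open>The Hessian, \<open>matA\<close> and their invertibility at \<open>x0\<close>\<close>

theorem theorem4p7:
  fixes \<Omega> \<Omega>' U :: "(real^2) set"
    and T S :: "real^2 \<Rightarrow> real^2"
    and \<rho> :: "real^2 \<Rightarrow> real"
    and x0 :: "real^2"
    and \<kappa> a z0 :: real
  assumes "open \<Omega>" "simply_connected \<Omega>" "open \<Omega>'" "simply_connected \<Omega>'"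
    and "\<kappa> > 1" and "x0 \<in> \<Omega>"
    and "C1_on T \<Omega>" and "bij_betw T \<Omega> \<Omega>'"
    and "S = (\<lambda>x. T x - x)"
    and "\<forall>\<^sub>F x in nhds x0. curl2 S x = 0"
    and "\<forall>\<^sub>F x in nhds x0. cross2 (S x) (grad (\<lambda>y. (norm (S y))\<^sup>2) x) = 0"
    and "a > 0" and "a > norm (S x0) / sqrt (\<kappa>\<^sup>2 - 1)"
    and "open U" "x0 \<in> U" "U \<subseteq> \<Omega>"
    and "C2_on \<rho> U"
    and "\<forall>x\<in>U. \<rho> x > 0"
    and "\<forall>x\<in>U. grad (\<lambda>y. a - \<rho> y) x =
           (\<kappa> *\<^sub>R (S x /\<^sub>R (a - \<rho> x))) /\<^sub>R (\<kappa> - sqrt ((norm (S x /\<^sub>R (a - \<rho> x)))\<^sup>2 + 1))"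
    and "a - \<rho> x0 = z0" and "a > z0" and "z0 > norm (S x0) / sqrt (\<kappa>\<^sup>2 - 1)"
  shows "let s = S x0; DS = D S x0;
             y0 = (norm (s /\<^sub>R z0))\<^sup>2;
             \<phi> = phi \<kappa> y0; \<phi>' = deriv (phi \<kappa>) y0;
             M = mat 1 + (2 / z0\<^sup>2 * (\<phi>' / \<phi>)) *\<^sub>R outer s s
         in
           hess \<rho> x0 = (\<phi> / z0) *\<^sub>R (M ** ((\<phi> / z0\<^sup>2) *\<^sub>R outer s s - DS)) \<and>
           matA \<kappa> a \<rho> x0 = M ** (mat 1 + DS) \<and>
           D T x0 = mat 1 + DS \<and>
           (invertible (matA \<kappa> a \<rho> x0) \<longleftrightarrow> invertible (D T x0)) \<and>
           (invertible (D T x0) \<longleftrightarrow> local_diffeomorphism_at T \<Omega> x0) \<and>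
           (s = 0 \<longrightarrow> (invertible (hess \<rho> x0) \<longleftrightarrow> invertible DS)) \<and>
           (s \<noteq> 0 \<longrightarrow>
              (\<exists>\<zeta>. DS *v s = \<zeta> *\<^sub>R s) \<and>
              (\<exists>\<zeta>p. DS *v perp s = \<zeta>p *\<^sub>R perp s) \<and>
              (\<forall>\<zeta> \<zeta>p. DS *v s = \<zeta> *\<^sub>R s \<and> DS *v perp s = \<zeta>p *\<^sub>R perp s \<longrightarrow>
                 (invertible (hess \<rho> x0) \<longleftrightarrow>
                    \<zeta> \<noteq> (norm s)\<^sup>2 / z0\<^sup>2 * \<phi> \<and> \<zeta>p \<noteq> 0)))"

proof -
  define DS where "DS = D S x0"
  define s where "s = S x0"
  define y0 where "y0 = (norm (s /\<^sub>R z0))\<^sup>2"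
  define p where "p = phi \<kappa> y0"
  define p' where "p' = deriv (phi \<kappa>) y0"
  define M where "M = mat 1 + (2 / z0\<^sup>2 * (p' / p)) *\<^sub>R outer s s"
  note \<kappa> = \<open>\<kappa> > 1\<close>
  have "\<kappa>\<^sup>2 > 1"
    using \<kappa> by simp
  then have "norm s / sqrt (\<kappa>\<^sup>2 - 1) \<ge> 0"
    by simp
  then have z0: "z0 > 0"
    using \<open>z0 > norm (S x0) / sqrt (\<kappa>\<^sup>2 - 1)\<close> unfolding s_def by linarith
  have y0': "y0 = (norm s)\<^sup>2 / z0\<^sup>2"
    by (simp add: y0_def power_mult_distrib divide_simps)
  have "norm s < z0 * sqrt (\<kappa>\<^sup>2 - 1)"
    using \<open>z0 > norm (S x0) / sqrt (\<kappa>\<^sup>2 - 1)\<close> \<open>\<kappa>\<^sup>2 > 1\<close>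
    by (simp add: s_def field_simps)
  then have "(norm s)\<^sup>2 < (z0 * sqrt (\<kappa>\<^sup>2 - 1))\<^sup>2"
    by (intro power_strict_mono) auto
  \<comment> \<open>The lower bound on \<open>z0\<close> is exactly what puts \<open>y0\<close> into
    the domain of \<phi>.\<close>
  then have y0: "0 \<le> y0" "y0 < \<kappa>\<^sup>2 - 1"
    using z0 \<open>\<kappa>\<^sup>2 > 1\<close> by (auto simp: y0' power_mult_distrib field_simps)
  have p: "p > 0"
    unfolding p_def using \<kappa> y0 by (rule phi_pos)
  have p': "p' \<ge> 0"
    unfolding p'_def deriv_phi_eq[OF \<kappa> y0] using \<kappa> y0 by simp

  have T: "T differentiable (at x0)"
    using \<open>C1_on T \<Omega>\<close> \<open>x0 \<in> \<Omega>\<close> by (simp add: C1_on_def)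
  then have "(T has_derivative (*v) (D T x0)) (at x0)"
    by (simp add: jacobian_works)
  from has_derivative_diff[OF this has_derivative_ident]
  have "(S has_derivative (\<lambda>h. D T x0 *v h - h)) (at x0)"
    unfolding \<open>S = (\<lambda>x. T x - x)\<close> .
  moreover have "(*v) (D T x0 - mat 1) = (\<lambda>h. D T x0 *v h - h)"
    by (simp add: fun_eq_iff matrix_vector_mult_diff_rdistrib)
  ultimately have "(S has_derivative (*v) (D T x0 - mat 1)) (at x0)"
    by simp
  moreover from this have "DS = D T x0 - mat 1"
    unfolding DS_def by (rule D_eqI)
  ultimately have S: "(S has_derivative (*v) DS) (at x0)" and DT: "D T x0 = mat 1 + DS"
    by auto

  \<comment> \<open>The equation is solved for D\<rho> on all of \<open>U\<close>, not only at
    \<open>x0\<close>, because it is about to be differentiated.\<close>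
  have grad_neg: "grad \<rho> x = - (phi \<kappa> ((norm (S x /\<^sub>R (a - \<rho> x)))\<^sup>2) / (a - \<rho> x)) *\<^sub>R S x"
    and w': "((\<lambda>y. a - \<rho> y) has_derivative (\<lambda>h. - grad \<rho> x \<bullet> h)) (at x)" if "x \<in> U" for x
  proof -
    have "\<rho> differentiable (at x)"
      using \<open>C2_on \<rho> U\<close> that by (simp add: C2_on_def)
    then show d: "((\<lambda>y. a - \<rho> y) has_derivative (\<lambda>h. - grad \<rho> x \<bullet> h)) (at x)"
      using has_derivative_diff[OF has_derivative_const has_derivative_grad] by simp
    have "- grad \<rho> x = (phi \<kappa> ((norm (S x /\<^sub>R (a - \<rho> x)))\<^sup>2) / (a - \<rho> x)) *\<^sub>R S x"
      using grad_eqI[OF d] bspec[OF assms(19) that] by (simp add: phi_def divide_inverse mult_ac)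
    then show "grad \<rho> x = - (phi \<kappa> ((norm (S x /\<^sub>R (a - \<rho> x)))\<^sup>2) / (a - \<rho> x)) *\<^sub>R S x"
      by (metis add.inverse_inverse scaleR_minus_left)
  qed
  have grad0: "grad \<rho> x0 = - (p / z0) *\<^sub>R s"
    using grad_neg[OF \<open>x0 \<in> U\<close>] by (simp only: \<open>a - \<rho> x0 = z0\<close> p_def y0_def s_def)
  \<comment> \<open>The equation itself gives the gradient of a - \<rho> at \<open>x0\<close>, in
    the form that \<open>has_derivative_scaled_field\<close> expects.\<close>
  have w: "((\<lambda>y. a - \<rho> y) has_derivative (\<lambda>h. (p / z0) * (s \<bullet> h))) (at x0)"
    using w'[OF \<open>x0 \<in> U\<close>] by (simp add: grad0)
  have "((\<lambda>x. - (phi \<kappa> ((norm (S x /\<^sub>R (a - \<rho> x)))\<^sup>2) / (a - \<rho> x)) *\<^sub>R S x) has_derivative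
      (*v) ((p / z0) *\<^sub>R (M ** ((p / z0\<^sup>2) *\<^sub>R outer s s - DS)))) (at x0)"
    unfolding M_def
  proof (rule has_derivative_scaled_field[OF S w])
    show "(phi \<kappa> has_real_derivative p') (at ((norm (s /\<^sub>R z0))\<^sup>2))"
      using phi_has_real_derivative[OF \<kappa> y0] unfolding p'_def y0_def .
  qed (use z0 p \<open>a - \<rho> x0 = z0\<close> in \<open>auto simp: s_def p_def y0_def\<close>)
  then have "(grad \<rho> has_derivative (*v) ((p / z0) *\<^sub>R (M ** ((p / z0\<^sup>2) *\<^sub>R outer s s - DS)))) (at x0)"
    by (rule has_derivative_transform_within_open[OF _ \<open>open U\<close> \<open>x0 \<in> U\<close>]) (simp only: grad_neg)
  then have hess: "hess \<rho> x0 = (p / z0) *\<^sub>R (M ** ((p / z0\<^sup>2) *\<^sub>R outer s s - DS))"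
    unfolding hess_def by (rule D_eqI)

  have "(norm (grad \<rho> x0))\<^sup>2 = p\<^sup>2 * y0"
    unfolding grad0 using z0 by (simp add: y0' power_mult_distrib power_divide)
  then have Delta: "\<kappa>\<^sup>2 + Delta \<kappa> \<rho> x0 = (\<kappa>\<^sup>2 - 1) * p"
    unfolding Delta_def p_def using Delta_identity[OF \<kappa> y0] by simp
  have outer_grad: "outer (grad \<rho> x0) (grad \<rho> x0) = (p\<^sup>2 / z0\<^sup>2) *\<^sub>R outer s s"
    unfolding grad0 by (simp add: outer_def vec_eq_iff power2_eq_square)
  have "matA \<kappa> a \<rho> x0 = mat 1 + ((\<kappa>\<^sup>2 - 1) / \<kappa>\<^sup>2 * (p\<^sup>2 / z0\<^sup>2)) *\<^sub>R outer s s
      + ((1 - \<kappa>\<^sup>2) * z0 / ((\<kappa>\<^sup>2 - 1) * p) * (p / z0)) *\<^sub>R (M ** ((p / z0\<^sup>2) *\<^sub>R outer s s - DS))"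
    unfolding matA_def Delta outer_grad hess \<open>a - \<rho> x0 = z0\<close> by simp
  also have "(1 - \<kappa>\<^sup>2) * z0 / ((\<kappa>\<^sup>2 - 1) * p) * (p / z0) = - 1"
    using z0 p \<open>\<kappa>\<^sup>2 > 1\<close> by (simp add: divide_simps)
  also have "mat 1 + ((\<kappa>\<^sup>2 - 1) / \<kappa>\<^sup>2 * (p\<^sup>2 / z0\<^sup>2)) *\<^sub>R outer s s
      + (- 1) *\<^sub>R (M ** ((p / z0\<^sup>2) *\<^sub>R outer s s - DS)) = M ** (mat 1 + DS)"
  proof -
    \<comment> \<open>With \<open>y0\<close> = |s|^2 / \<open>z0\<^sup>2\<close>, the coefficient
      condition of \<open>mat_plus_outer_mult\<close> becomes \<open>phi_identity\<close> divided by
      \<open>z0\<^sup>2\<close>.\<close>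
    have "(\<kappa>\<^sup>2 - 1) / \<kappa>\<^sup>2 * (p\<^sup>2 / z0\<^sup>2) - p / z0\<^sup>2 * (1 + 2 / z0\<^sup>2 * (p' / p) * (norm s)\<^sup>2)
        = ((\<kappa>\<^sup>2 - 1) / \<kappa>\<^sup>2 * p\<^sup>2 - p - 2 * p' * y0) / z0\<^sup>2"
      unfolding y0' using p z0 by (simp add: diff_divide_distrib distrib_left)
    also have "\<dots> = 2 / z0\<^sup>2 * (p' / p)"
      unfolding p_def p'_def phi_identity[OF \<kappa> y0] by simp
    finally show ?thesis
      using mat_plus_outer_mult unfolding M_def by simp
  qed
  finally have matA: "matA \<kappa> a \<rho> x0 = M ** (mat 1 + DS)" .

  have "det M = 1 + 2 / z0\<^sup>2 * (p' / p) * (norm s)\<^sup>2"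
    unfolding M_def by (rule det_mat_plus_outer)
  moreover have "2 / z0\<^sup>2 * (p' / p) * (norm s)\<^sup>2 \<ge> 0"
    using p p' by simp
  ultimately have detM: "det M \<noteq> 0"
    by simp
  have inv_matA: "invertible (matA \<kappa> a \<rho> x0) \<longleftrightarrow> invertible (D T x0)"
    unfolding matA DT invertible_det_nz det_mul using detM by simp
  have inv_DT: "invertible (D T x0) \<longleftrightarrow> local_diffeomorphism_at T \<Omega> x0"
    using invertible_D_if_local_diffeomorphism local_diffeomorphism_if_invertible_D
      \<open>open \<Omega>\<close> \<open>x0 \<in> \<Omega>\<close> \<open>C1_on T \<Omega>\<close> by blast
  have inv_hess: "invertible (hess \<rho> x0) \<longleftrightarrow> det ((p / z0\<^sup>2) *\<^sub>R outer s s - DS) \<noteq> 0"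
  proof -
    have "det (c *\<^sub>R B) = c\<^sup>2 * det B" for c and B :: "real^2^2"
      by (simp add: det_2 power2_eq_square algebra_simps)
    then show ?thesis
      unfolding hess invertible_det_nz using detM p z0 by (simp add: det_mul)
  qed
  have fixed: "invertible (hess \<rho> x0) \<longleftrightarrow> invertible DS" if "s = 0"
  proof -
    have "det ((p / z0\<^sup>2) *\<^sub>R outer s s - DS) = det DS"
      by (simp add: that det_2 outer_def)
    then show ?thesis
      using inv_hess by (simp add: invertible_det_nz)
  qed

  have sym: "DS $ 2 $ 1 = DS $ 1 $ 2"
    using eventually_nhds_x_imp_x[OF assms(10)] by (simp add: curl2_def DS_def)
  \<comment> \<open>In general this gradient is 2 DS^t S; zero curl makes \<open>DS\<close>
    symmetric, which removes the transpose and turns the second condition on \<open>S\<close> into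
    parallelism of \<open>DS *v s\<close> and \<open>s\<close>.\<close>
  have "grad (\<lambda>y. (norm (S y))\<^sup>2) x0 = 2 *\<^sub>R (DS *v s)"
  proof (rule grad_eqI)
    have "s \<bullet> (DS *v h) = (DS *v s) \<bullet> h" for h
      by (simp add: inner_vec_def matrix_vector_mult_def sum_2 sym algebra_simps)
    then show "((\<lambda>y. (norm (S y))\<^sup>2) has_derivative (\<lambda>h. 2 *\<^sub>R (DS *v s) \<bullet> h)) (at x0)"
      using has_derivative_norm_square[OF S] by (simp add: s_def)
  qed
  then have cross: "cross2 s (DS *v s) = 0"
    using eventually_nhds_x_imp_x[OF assms(11)] by (simp add: cross2_def s_def)
  have eigen: "\<exists>\<zeta>. DS *v s = \<zeta> *\<^sub>R s" "\<exists>\<zeta>. DS *v perp s = \<zeta> *\<^sub>R perp s" if "s \<noteq> 0"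
    using symmetric_eigenvectors[OF sym cross that] by auto
  have inv_hess': "invertible (hess \<rho> x0) \<longleftrightarrow> \<zeta> \<noteq> (norm s)\<^sup>2 / z0\<^sup>2 * p \<and> \<zeta>p \<noteq> 0"
    if "s \<noteq> 0" "DS *v s = \<zeta> *\<^sub>R s" "DS *v perp s = \<zeta>p *\<^sub>R perp s" for \<zeta> \<zeta>p
  proof -
    have "s \<bullet> perp s = 0"
      by (simp add: inner_vec_def perp_def sum_2)
    \<comment> \<open>The matrix \<open>outer s s\<close> multiplies \<open>s\<close> by |s|^2 and
      annihilates \<open>perp s\<close>, so the difference has the two factors as eigenvalues on
      \<open>s\<close> and \<open>perp s\<close>.\<close>
    then have "det ((p / z0\<^sup>2) *\<^sub>R outer s s - DS) = (p / z0\<^sup>2 * (norm s)\<^sup>2 - \<zeta>) * (- \<zeta>p)"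
      using that
      by (intro det_eq_prod_of_orthogonal_eigenvalues)
        (simp_all add: outer_mult_vector matrix_vector_mult_diff_rdistrib power2_norm_eq_inner
          scaleR_diff_left flip: scaleR_matrix_vector_assoc)
    then show ?thesis
      unfolding inv_hess by auto
  qed
  show ?thesis
    unfolding Let_def
    using hess matA DT inv_matA inv_DT fixed eigen inv_hess'
    unfolding M_def p_def p'_def y0_def s_def DS_def by blast
qed

end
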